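(* Every skew left brace can be embedded into a Rota--Baxter group; that is, for every skew left brace $(G,\cdot,\circ)$ there exist a group $(H,* )$, a Rota--Baxter operator $B$ on $(H,* )$, and an injective map $\psi\colon G\to H$ such that for all $g,h\in G$ $$\psi(g\cdot h)=\psi(g)*\psi(h),\qquad \psi(g\circ h)=\psi(g)\circ_B\psi(h),$$ where $x\circ_B y=x*B(x)*y*B(x)^{-1}$ for $x,y\in H$.
   Context: A skew left brace is a set $A$ with two binary operations $\cdot$ and $\circ$ such that $(A,\cdot)$ and $(A,\circ)$ are groups and $a\circ(b\cdot c)=(a\circ b)\cdot a^{-1}\cdot(a\circ c)$ for all $a,b,c\in A$, where $a^{-1}$ is the inverse of $a$ in $(A,\cdot)$. A Rota--Baxter operator (of weight 1) on a group $H$ is a map $B\colon H\to H$ such that $B(g)B(h)=B(gB(g)hB(g)^{-1})$ for all $g,h\in H$; a Rota--Baxter group is a group endowed with a Rota--Baxter operator. Every Rota--Baxter group $(H,*,B)$ gives a skew left brace $H(B)=(H,*,\circ_B)$ with $x\circ_B y=x*B(x)*y*B(x)^{-1}$; embedding a skew left brace into the Rota--Baxter group means embedding it injectively, as a skew left brace, into $H(B)$. *)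

theory Defs
  imports "HOL-Algebra.Group"
begin

text \<open>The group \<open>(A, \<cdot>)\<close> is \<open>A\<close> and the group \<open>(A, \<circ>)\<close> is \<open>C\<close>, on the same carrier.
  The inverse in the compatibility axiom is that of \<open>A\<close>.\<close>

locale skew_left_brace =
  dot: group A + circ: group C
  for A :: "('a, 'm) monoid_scheme" and C :: "('a, 'n) monoid_scheme" +
  assumes carrier_eq: "carrier C = carrier A"
    and brace_compat:
      "\<lbrakk>a \<in> carrier A; b \<in> carrier A; c \<in> carrier A\<rbrakk> \<Longrightarrow>
        a \<otimes>\<^bsub>C\<^esub> (b \<otimes>\<^bsub>A\<^esub> c) =
          (a \<otimes>\<^bsub>C\<^esub> b) \<otimes>\<^bsub>A\<^esub> inv\<^bsub>A\<^esub> a \<otimes>\<^bsub>A\<^esub> (a \<otimes>\<^bsub>C\<^esub> c)"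

locale rota_baxter_group = group H
  for H :: "('a, 'm) monoid_scheme" (structure) +
  fixes B :: "'a \<Rightarrow> 'a"
  assumes rb_closed: "B \<in> carrier H \<rightarrow> carrier H"
    and rota_baxter:
      "\<lbrakk>g \<in> carrier H; h \<in> carrier H\<rbrakk> \<Longrightarrow>
        B g \<otimes> B h = B (g \<otimes> B g \<otimes> h \<otimes> inv (B g))"

definition rb_circ :: "('a, 'm) monoid_scheme \<Rightarrow> ('a \<Rightarrow> 'a) \<Rightarrow> 'a \<Rightarrow> 'a \<Rightarrow> 'a" where
  "rb_circ H B x y = x \<otimes>\<^bsub>H\<^esub> B x \<otimes>\<^bsub>H\<^esub> y \<otimes>\<^bsub>H\<^esub> inv\<^bsub>H\<^esub> (B x)"

end

theory Submission
  imports Defs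
begin

text \<open>
  For a skew left brace \<open>(G, \<cdot>, \<circ>)\<close> put \<open>\<lambda>\<^sub>a b = a\<^sup>-\<^sup>1 \<cdot> (a \<circ> b)\<close>. The compatibility axiom says
  exactly that each \<open>\<lambda>\<^sub>a\<close> respects \<open>\<cdot>\<close>, and it implies that \<open>\<lambda>\<close> is an action of \<open>(G, \<circ>)\<close>
  (\<open>lam_mult\<close>, \<open>lam_circ\<close>). Hence there is the semidirect product \<open>H\<close> of \<open>(G, \<cdot>)\<close> by
  \<open>(G, \<circ>)\<close>, with product \<open>(a, x)(b, y) = (a \<cdot> \<lambda>\<^sub>x b, x \<circ> y)\<close>.

  A factorization \<open>H = K L\<close> into two subgroups with trivial intersection always yields a
  Rota--Baxter operator, \<open>B (k l) = l\<^sup>-\<^sup>1\<close>: for \<open>g = k l\<close> and \<open>h = k' l'\<close> the element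
  \<open>g B(g) h B(g)\<^sup>-\<^sup>1\<close> is \<open>k k' l' l\<close>, whose \<open>L\<close>-part \<open>l' l\<close> has inverse \<open>B(g) B(h)\<close>.

  The factorization to take is \<open>K = {(a, a)}\<close>, \<open>L = {(1, x)}\<close>. The diagonal \<open>K\<close> is closed
  under products because \<open>a \<cdot> \<lambda>\<^sub>a b = a \<circ> b\<close>. The \<open>L\<close>-part of \<open>(a, x)\<close> is
  \<open>(1, a' \<circ> x)\<close>, where the prime is the inverse for \<open>\<circ>\<close>, so \<open>B (a, x) = (1, x' \<circ> a)\<close>.
  With \<open>\<psi> g = (g, 1)\<close> one gets \<open>B (\<psi> g) = (1, g)\<close>, and conjugation by this element is
  \<open>\<lambda>\<^sub>g\<close> on the image of \<open>\<psi>\<close>. Therefore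
  \<open>\<psi> g \<circ>\<^sub>B \<psi> h = \<psi> (g \<cdot> \<lambda>\<^sub>g h) = \<psi> (g \<circ> h)\<close>.
\<close>

context skew_left_brace
begin

definition lam :: "'a \<Rightarrow> 'a \<Rightarrow> 'a" where
  "lam a b = inv\<^bsub>A\<^esub> a \<otimes>\<^bsub>A\<^esub> (a \<otimes>\<^bsub>C\<^esub> b)"

lemma circ_carrier [simp]:
  "a \<in> carrier A \<Longrightarrow> b \<in> carrier A \<Longrightarrow> a \<otimes>\<^bsub>C\<^esub> b \<in> carrier A"
  "a \<in> carrier A \<Longrightarrow> inv\<^bsub>C\<^esub> a \<in> carrier A"
  using circ.m_closed circ.inv_closed carrier_eq by auto

lemma lam_closed [simp]: "a \<in> carrier A \<Longrightarrow> b \<in> carrier A \<Longrightarrow> lam a b \<in> carrier A"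
  by (simp add: lam_def)

lemma dot_lam: "a \<in> carrier A \<Longrightarrow> b \<in> carrier A \<Longrightarrow> a \<otimes>\<^bsub>A\<^esub> lam a b = a \<otimes>\<^bsub>C\<^esub> b"
  by (simp add: lam_def dot.m_assoc [symmetric])

lemma lam_mult:
  assumes "a \<in> carrier A" "b \<in> carrier A" "c \<in> carrier A"
  shows "lam a (b \<otimes>\<^bsub>A\<^esub> c) = lam a b \<otimes>\<^bsub>A\<^esub> lam a c"
  using assms by (simp add: lam_def brace_compat dot.m_assoc)

lemma lam_one_right:
  assumes "a \<in> carrier A"
  shows "lam a \<one>\<^bsub>A\<^esub> = \<one>\<^bsub>A\<^esub>"
  using lam_mult [OF assms dot.one_closed dot.one_closed] assms by simp

text \<open>Since \<open>\<lambda>\<^sub>a\<close> fixes the neutral element of \<open>\<cdot>\<close>, that element is also right neutral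
  for \<open>\<circ>\<close>.\<close>

lemma one_eq: "\<one>\<^bsub>C\<^esub> = \<one>\<^bsub>A\<^esub>"
proof -
  have one_C: "\<one>\<^bsub>C\<^esub> \<in> carrier A"
    using circ.one_closed carrier_eq by simp
  have "\<one>\<^bsub>C\<^esub> \<otimes>\<^bsub>C\<^esub> \<one>\<^bsub>A\<^esub> = \<one>\<^bsub>C\<^esub>"
    using dot_lam [OF one_C dot.one_closed] lam_one_right [OF one_C] one_C by simp
  then show ?thesis
    by (simp add: carrier_eq)
qed

lemma lam_one: "a \<in> carrier A \<Longrightarrow> lam \<one>\<^bsub>A\<^esub> a = a"
  using circ.l_one [of a] by (simp add: lam_def one_eq carrier_eq)

text \<open>Both sides become \<open>a \<circ> b \<circ> c\<close> after left multiplication by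
  \<open>a \<circ> b = a \<cdot> \<lambda>\<^sub>a b\<close>.\<close>

lemma lam_circ:
  assumes "a \<in> carrier A" "b \<in> carrier A" "c \<in> carrier A"
  shows "lam (a \<otimes>\<^bsub>C\<^esub> b) c = lam a (lam b c)"
proof -
  have "(a \<otimes>\<^bsub>C\<^esub> b) \<otimes>\<^bsub>A\<^esub> lam a (lam b c) = a \<otimes>\<^bsub>A\<^esub> lam a b \<otimes>\<^bsub>A\<^esub> lam a (lam b c)"
    using assms by (simp add: dot_lam)
  also have "\<dots> = a \<otimes>\<^bsub>A\<^esub> lam a (b \<otimes>\<^bsub>A\<^esub> lam b c)"
    using assms by (simp add: lam_mult dot.m_assoc)
  also have "\<dots> = a \<otimes>\<^bsub>C\<^esub> (b \<otimes>\<^bsub>C\<^esub> c)"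
    using assms by (simp add: dot_lam)
  also have "\<dots> = (a \<otimes>\<^bsub>C\<^esub> b) \<otimes>\<^bsub>A\<^esub> lam (a \<otimes>\<^bsub>C\<^esub> b) c"
    using assms by (simp add: dot_lam circ.m_assoc carrier_eq)
  finally show ?thesis
    using assms by simp
qed

definition semidirect :: "('a \<times> 'a) monoid" where
  "semidirect =
    \<lparr>carrier = carrier A \<times> carrier A,
     mult = (\<lambda>p q. (fst p \<otimes>\<^bsub>A\<^esub> lam (snd p) (fst q), snd p \<otimes>\<^bsub>C\<^esub> snd q)),
     one = (\<one>\<^bsub>A\<^esub>, \<one>\<^bsub>A\<^esub>)\<rparr>"

definition rb_op :: "'a \<times> 'a \<Rightarrow> 'a \<times> 'a" where
  "rb_op p = (\<one>\<^bsub>A\<^esub>, inv\<^bsub>C\<^esub> (snd p) \<otimes>\<^bsub>C\<^esub> fst p)"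

lemma semidirect_simps [simp]:
  "carrier semidirect = carrier A \<times> carrier A"
  "(a, x) \<otimes>\<^bsub>semidirect\<^esub> (b, y) = (a \<otimes>\<^bsub>A\<^esub> lam x b, x \<otimes>\<^bsub>C\<^esub> y)"
  "\<one>\<^bsub>semidirect\<^esub> = (\<one>\<^bsub>A\<^esub>, \<one>\<^bsub>A\<^esub>)"
  by (simp_all add: semidirect_def)

lemma circ_simps:
  "a \<in> carrier A \<Longrightarrow> \<one>\<^bsub>A\<^esub> \<otimes>\<^bsub>C\<^esub> a = a"
  "a \<in> carrier A \<Longrightarrow> a \<otimes>\<^bsub>C\<^esub> \<one>\<^bsub>A\<^esub> = a"
  "a \<in> carrier A \<Longrightarrow> inv\<^bsub>C\<^esub> a \<otimes>\<^bsub>C\<^esub> a = \<one>\<^bsub>A\<^esub>"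
  "a \<in> carrier A \<Longrightarrow> a \<otimes>\<^bsub>C\<^esub> inv\<^bsub>C\<^esub> a = \<one>\<^bsub>A\<^esub>"
  "inv\<^bsub>C\<^esub> \<one>\<^bsub>A\<^esub> = \<one>\<^bsub>A\<^esub>"
  using circ.l_one [of a] circ.r_one [of a] circ.l_inv [of a] circ.r_inv [of a] circ.inv_one
  by (simp_all add: one_eq carrier_eq)

lemma group_semidirect: "group semidirect"
proof (rule groupI)
  fix p assume "p \<in> carrier semidirect"
  then obtain a x where p: "p = (a, x)" "a \<in> carrier A" "x \<in> carrier A"
    by auto
  have "lam (inv\<^bsub>C\<^esub> x) (inv\<^bsub>A\<^esub> a) \<otimes>\<^bsub>A\<^esub> lam (inv\<^bsub>C\<^esub> x) a = \<one>\<^bsub>A\<^esub>"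
    using p by (simp add: lam_mult [symmetric] lam_one_right)
  then have "(lam (inv\<^bsub>C\<^esub> x) (inv\<^bsub>A\<^esub> a), inv\<^bsub>C\<^esub> x) \<otimes>\<^bsub>semidirect\<^esub> p = \<one>\<^bsub>semidirect\<^esub>"
    using p by (simp add: circ_simps)
  then show "\<exists>q \<in> carrier semidirect. q \<otimes>\<^bsub>semidirect\<^esub> p = \<one>\<^bsub>semidirect\<^esub>"
    by (rule bexI) (use p in simp)
qed (auto simp: lam_mult lam_circ lam_one circ_simps dot.m_assoc circ.m_assoc carrier_eq)

lemma inv_semidirect_complement:
  assumes "x \<in> carrier A"
  shows "inv\<^bsub>semidirect\<^esub> (\<one>\<^bsub>A\<^esub>, x) = (\<one>\<^bsub>A\<^esub>, inv\<^bsub>C\<^esub> x)"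
  using assms
  by (intro group.inv_equality [OF group_semidirect]) (simp_all add: lam_one_right circ_simps)

text \<open>Right multiplication by \<open>B (a, x)\<close> removes the \<open>L\<close>-part of \<open>(a, x)\<close> and leaves its
  diagonal part.\<close>

lemma mult_rb_op:
  assumes "a \<in> carrier A" "x \<in> carrier A"
  shows "(a, x) \<otimes>\<^bsub>semidirect\<^esub> rb_op (a, x) = (a, a)"
  using assms
  by (simp add: rb_op_def lam_one_right circ_simps circ.m_assoc [symmetric] carrier_eq)

lemma rota_baxter_semidirect: "rota_baxter_group semidirect rb_op"
proof (intro rota_baxter_group.intro rota_baxter_group_axioms.intro group_semidirect)
  show "rb_op \<in> carrier semidirect \<rightarrow> carrier semidirect"
    by (auto simp: rb_op_def)
next
  fix g h assume "g \<in> carrier semidirect" "h \<in> carrier semidirect"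
  then obtain a x b y where g: "g = (a, x)" and h: "h = (b, y)"
    and mem: "a \<in> carrier A" "x \<in> carrier A" "b \<in> carrier A" "y \<in> carrier A"
    by auto
  let ?w = "inv\<^bsub>C\<^esub> a \<otimes>\<^bsub>C\<^esub> x"
  have inv: "inv\<^bsub>semidirect\<^esub> (rb_op g) = (\<one>\<^bsub>A\<^esub>, ?w)"
    using mem by (simp add: g rb_op_def inv_semidirect_complement circ.inv_mult_group carrier_eq)
  have "g \<otimes>\<^bsub>semidirect\<^esub> rb_op g \<otimes>\<^bsub>semidirect\<^esub> h \<otimes>\<^bsub>semidirect\<^esub> inv\<^bsub>semidirect\<^esub> (rb_op g)
      = (a \<otimes>\<^bsub>C\<^esub> b, a \<otimes>\<^bsub>C\<^esub> y \<otimes>\<^bsub>C\<^esub> ?w)"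
    unfolding inv unfolding g h mult_rb_op [OF mem(1,2)]
    using mem by (simp add: dot_lam lam_one_right)
  moreover have "inv\<^bsub>C\<^esub> (a \<otimes>\<^bsub>C\<^esub> y \<otimes>\<^bsub>C\<^esub> ?w) \<otimes>\<^bsub>C\<^esub> (a \<otimes>\<^bsub>C\<^esub> b)
      = inv\<^bsub>C\<^esub> x \<otimes>\<^bsub>C\<^esub> a \<otimes>\<^bsub>C\<^esub> (inv\<^bsub>C\<^esub> y \<otimes>\<^bsub>C\<^esub> b)"
  proof -
    have "inv\<^bsub>C\<^esub> a \<otimes>\<^bsub>C\<^esub> (a \<otimes>\<^bsub>C\<^esub> b) = b"
      using mem by (simp add: circ.m_assoc [symmetric] carrier_eq)
    then show ?thesis
      using mem by (simp add: circ.inv_mult_group circ.m_assoc carrier_eq)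
  qed
  ultimately show "rb_op g \<otimes>\<^bsub>semidirect\<^esub> rb_op h = rb_op
      (g \<otimes>\<^bsub>semidirect\<^esub> rb_op g \<otimes>\<^bsub>semidirect\<^esub> h \<otimes>\<^bsub>semidirect\<^esub> inv\<^bsub>semidirect\<^esub> (rb_op g))"
    using mem by (simp add: rb_op_def g h lam_one_right)
qed

lemma rb_circ_semidirect:
  assumes "g \<in> carrier A" "h \<in> carrier A"
  shows "rb_circ semidirect rb_op (g, \<one>\<^bsub>A\<^esub>) (h, \<one>\<^bsub>A\<^esub>) = (g \<otimes>\<^bsub>C\<^esub> h, \<one>\<^bsub>A\<^esub>)"
proof -
  have "inv\<^bsub>semidirect\<^esub> (rb_op (g, \<one>\<^bsub>A\<^esub>)) = (\<one>\<^bsub>A\<^esub>, inv\<^bsub>C\<^esub> g)"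
    using assms by (simp add: rb_op_def circ_simps inv_semidirect_complement)
  then show ?thesis
    using assms by (simp add: rb_circ_def mult_rb_op dot_lam lam_one_right circ_simps)
qed

end

theorem theorem3p6:
  fixes G :: "('a, 'm) monoid_scheme" and C :: "('a, 'n) monoid_scheme"
  assumes "skew_left_brace G C"
  shows "\<exists>(H :: ('a \<times> 'a) monoid) (B :: 'a \<times> 'a \<Rightarrow> 'a \<times> 'a) (\<psi> :: 'a \<Rightarrow> 'a \<times> 'a).
    rota_baxter_group H B \<and>
    \<psi> \<in> carrier G \<rightarrow> carrier H \<and>
    inj_on \<psi> (carrier G) \<and>
    (\<forall>g \<in> carrier G. \<forall>h \<in> carrier G.
      \<psi> (g \<otimes>\<^bsub>G\<^esub> h) = \<psi> g \<otimes>\<^bsub>H\<^esub> \<psi> h \<and>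
      \<psi> (g \<otimes>\<^bsub>C\<^esub> h) = rb_circ H B (\<psi> g) (\<psi> h))"
proof -
  interpret skew_left_brace G C
    by (fact assms)
  show ?thesis
    by (intro exI [of _ semidirect] exI [of _ rb_op] exI [of _ "\<lambda>g. (g, \<one>\<^bsub>G\<^esub>)"])
      (auto simp: rota_baxter_semidirect rb_circ_semidirect lam_one circ_simps inj_on_def)
qed

end
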